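(* Let $K_{ij}=K_{ji}$ ($0\le i,j\le N-1$) be real and let $\bm\rho^n>0$ componentwise. Let $\widetilde{\bm V}^n=\bm V+\mathcal{K}_h\bm\rho^n$ be the lagged potential, let $A_h^n=A_h(\bm\rho^n)$ be the generator assembled from the lagged rates $F^n_{i+\frac12}=\frac1{h^2}\gamma^n_{i+\frac12}e^{\widetilde V^n_i}$, $B^n_{i+\frac12}=\frac1{h^2}\gamma^n_{i+\frac12}e^{\widetilde V^n_{i+1}}$, and for $\Delta t>0$ let $\bm\rho^{n+1}$ solve $$(I-\Delta t\,A_h^n)\bm\rho^{n+1}=\bm\rho^n.$$ Then $\bm\rho^{n+1}>0$ componentwise. Write $\delta\bm\rho:=\bm\rho^{n+1}-\bm\rho^n$ and define $$\mathcal{I}_h^n:=-\bigl\langle\ln\bm\rho^{n+1}+\widetilde{\bm V}^n,\ A_h^n\bm\rho^{n+1}\bigr\rangle_h,\qquad \lambda_{h,+}:=\Bigl(\sup\Bigl\{\tfrac{\langle\mathcal{K}_h\bm u,\bm u\rangle_h}{\|\bm u\|_h^2}:\ \bm u\ne\bm 0,\ \textstyle\sum_iu_i=0\Bigr\}\Bigr)_+,$$ where $r_+:=\max\{r,0\}$. Then $\mathcal{I}_h^n\ge0$, and $$\mathcal{F}_h[\bm\rho^{n+1}]-\mathcal{F}_h[\bm\rho^n]=\mathcal{F}^n_{h,\mathrm{lag}}[\bm\rho^{n+1}]-\mathcal{F}^n_{h,\mathrm{lag}}[\bm\rho^n]+\mathcal{R}^n\ \le\ -\Delta t\,\mathcal{I}_h^n+\mathcal{R}^n,\qquad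 \mathcal{R}^n:=\tfrac12\bigl\langle\mathcal{K}_h\,\delta\bm\rho,\delta\bm\rho\bigr\rangle_h.$$ In particular: (1) If $\lambda_{h,+}=0$, i.e. $\mathcal{K}_h$ is negative semidefinite on the zero-mass subspace, then $\mathcal{F}_h[\bm\rho^{n+1}]-\mathcal{F}_h[\bm\rho^n]\le-\Delta t\,\mathcal{I}_h^n\le0$ for every $\Delta t>0$. (2) For a general symmetric kernel, if $\lambda_{h,+}\|\delta\bm\rho\|_h^2\le\Delta t\,\mathcal{I}_h^n$, then $\mathcal{F}_h[\bm\rho^{n+1}]-\mathcal{F}_h[\bm\rho^n]\le-\tfrac{\Delta t}{2}\mathcal{I}_h^n\le0$.
   Context: Uniform one-dimensional periodic grid with $N$ nodes $x_i$ and spacing $h>0$; indices are periodic modulo $N$; $V_i\in\mathbb{R}$ are nodal potential values and $K_{ij}=K(x_i,x_j)$ for an interaction kernel $K$. Notation: $\langle\bm u,\bm v\rangle_h=h\sum_iu_iv_i$, $\|\bm u\|_h^2=\langle\bm u,\bm u\rangle_h$, $(\mathcal{K}_h\bm u)_i=h\sum_{j=0}^{N-1}K_{ij}u_j$, so $\widetilde V_i^n=V_i+h\sum_jK_{ij}\rho_j^n$; $\ln\bm\rho$ is taken componentwise. True discrete free energy: $\mathcal{F}_h[\bm\rho]=h\sum_{i=0}^{N-1}(\rho_i\ln\rho_i-\rho_i+V_i\rho_i)+\frac12\langle\mathcal{K}_h\bm\rho,\bm\rho\rangle_h$. Lagged free energy: $\mathcal{F}^n_{h,\mathrm{lag}}[\bm\rho]=h\sum_i(\rho_i\ln\rho_i-\rho_i+\rho_i\widetilde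 V_i^n)$. Given rates $F_{i+\frac12},B_{i+\frac12}$, the generator is the matrix with $(A_h\bm\rho)_i=B_{i+\frac12}\rho_{i+1}-F_{i+\frac12}\rho_i-B_{i-\frac12}\rho_i+F_{i-\frac12}\rho_{i-1}$. The edge coefficient $\gamma^n_{i+\frac12}>0$ is any one of the following five reconstructions applied to $U=\widetilde V^n$, where $L(a,b)=\frac{b-a}{\ln b-\ln a}$ for $a\neq b$ and $L(a,a)=a$: $\sqrt{e^{-U_i}e^{-U_{i+1}}}$; $1/L(e^{U_i},e^{U_{i+1}})$; $\frac{2}{e^{U_i}+e^{U_{i+1}}}$; $\frac{e^{-U_i}+e^{-U_{i+1}}}{2}$; $L(e^{-U_i},e^{-U_{i+1}})$. *)

theory Defs
  imports Complex_Main "HOL-Library.Extended_Real"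
begin

text \<open>Grid functions are maps \<open>nat \<Rightarrow> real\<close> of which only the values at the nodes
  \<open>i < N\<close> matter.  The edge \<open>i + 1/2\<close> carries the index \<open>i\<close>; hence
  the edge \<open>i - 1/2\<close> carries the index \<open>nbr_left N i\<close>.\<close>

definition nbr_right :: "nat \<Rightarrow> nat \<Rightarrow> nat" where
  "nbr_right N i = (i + 1) mod N"

definition nbr_left :: "nat \<Rightarrow> nat \<Rightarrow> nat" where
  "nbr_left N i = (i + N - 1) mod N"

definition inner_h :: "nat \<Rightarrow> real \<Rightarrow> (nat \<Rightarrow> real) \<Rightarrow> (nat \<Rightarrow> real) \<Rightarrow> real" where
  "inner_h N h u v = h * (\<Sum>i<N. u i * v i)"

definition norm_h :: "nat \<Rightarrow> real \<Rightarrow> (nat \<Rightarrow> real) \<Rightarrow> real" where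
  "norm_h N h u = sqrt (inner_h N h u u)"

definition interaction :: "nat \<Rightarrow> real \<Rightarrow> (nat \<Rightarrow> nat \<Rightarrow> real) \<Rightarrow> (nat \<Rightarrow> real) \<Rightarrow> nat \<Rightarrow> real" where
  "interaction N h K u i = h * (\<Sum>j<N. K i j * u j)"

definition lagged_potential ::
  "nat \<Rightarrow> real \<Rightarrow> (nat \<Rightarrow> real) \<Rightarrow> (nat \<Rightarrow> nat \<Rightarrow> real) \<Rightarrow> (nat \<Rightarrow> real) \<Rightarrow> nat \<Rightarrow> real" where
  "lagged_potential N h V K \<rho> i = V i + interaction N h K \<rho> i"

definition free_energy ::
  "nat \<Rightarrow> real \<Rightarrow> (nat \<Rightarrow> real) \<Rightarrow> (nat \<Rightarrow> nat \<Rightarrow> real) \<Rightarrow> (nat \<Rightarrow> real) \<Rightarrow> real" where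
  "free_energy N h V K \<rho> =
     h * (\<Sum>i<N. \<rho> i * ln (\<rho> i) - \<rho> i + V i * \<rho> i)
     + 1/2 * inner_h N h (interaction N h K \<rho>) \<rho>"

text \<open>The third argument is the frozen potential, i.e. the lagged potential of the old density.\<close>

definition lagged_free_energy ::
  "nat \<Rightarrow> real \<Rightarrow> (nat \<Rightarrow> real) \<Rightarrow> (nat \<Rightarrow> real) \<Rightarrow> real" where
  "lagged_free_energy N h U \<rho> = h * (\<Sum>i<N. \<rho> i * ln (\<rho> i) - \<rho> i + \<rho> i * U i)"

definition log_mean :: "real \<Rightarrow> real \<Rightarrow> real" where
  "log_mean a b = (if a = b then a else (b - a) / (ln b - ln a))"

datatype reconstruction =
  Geometric | Inverse_Log_Mean | Harmonic | Arithmetic | Log_Mean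

fun edge_value :: "reconstruction \<Rightarrow> real \<Rightarrow> real \<Rightarrow> real" where
  "edge_value Geometric a b = sqrt (exp (- a) * exp (- b))"
| "edge_value Inverse_Log_Mean a b = 1 / log_mean (exp a) (exp b)"
| "edge_value Harmonic a b = 2 / (exp a + exp b)"
| "edge_value Arithmetic a b = (exp (- a) + exp (- b)) / 2"
| "edge_value Log_Mean a b = log_mean (exp (- a)) (exp (- b))"

definition edge_coeff :: "nat \<Rightarrow> reconstruction \<Rightarrow> (nat \<Rightarrow> real) \<Rightarrow> nat \<Rightarrow> real" where
  "edge_coeff N r U i = edge_value r (U i) (U (nbr_right N i))"

definition forward_rate ::
  "nat \<Rightarrow> real \<Rightarrow> reconstruction \<Rightarrow> (nat \<Rightarrow> real) \<Rightarrow> nat \<Rightarrow> real" where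
  "forward_rate N h r U i = 1 / h\<^sup>2 * edge_coeff N r U i * exp (U i)"

definition backward_rate ::
  "nat \<Rightarrow> real \<Rightarrow> reconstruction \<Rightarrow> (nat \<Rightarrow> real) \<Rightarrow> nat \<Rightarrow> real" where
  "backward_rate N h r U i = 1 / h\<^sup>2 * edge_coeff N r U i * exp (U (nbr_right N i))"

text \<open>The generator matrix, given by its action on grid functions.\<close>

definition generator ::
  "nat \<Rightarrow> (nat \<Rightarrow> real) \<Rightarrow> (nat \<Rightarrow> real) \<Rightarrow> (nat \<Rightarrow> real) \<Rightarrow> nat \<Rightarrow> real" where
  "generator N F B \<rho> i =
     B i * \<rho> (nbr_right N i) - F i * \<rho> i
     - B (nbr_left N i) * \<rho> i + F (nbr_left N i) * \<rho> (nbr_left N i)"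

text \<open>The supremum is taken in the extended reals: for \<open>N = 1\<close> the zero-mass subspace is
  trivial and the supremum is that of the empty set, so it must be \<open>-\<infinity>\<close>.\<close>

definition lambda_plus :: "nat \<Rightarrow> real \<Rightarrow> (nat \<Rightarrow> nat \<Rightarrow> real) \<Rightarrow> ereal" where
  "lambda_plus N h K =
     max (SUP u \<in> {u. (\<exists>i<N. u i \<noteq> 0) \<and> (\<Sum>i<N. u i) = 0}.
            ereal (inner_h N h (interaction N h K u) u / (norm_h N h u)\<^sup>2)) 0"

end

theory Submission
  imports Defs
begin

text \<open>
  Everything rests on the variable \<open>g i = exp (U i) * \<rho> i\<close>, in which the generator is the
  divergence of the gradient flux \<open>w i * (g (i + 1) - g i)\<close> with positive edge weights
  \<open>w = \<gamma> / h\<^sup>2\<close>; the reconstructions enter only through the positivity of \<open>\<gamma>\<close>.  In this form: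

  \<^item> At a node where \<open>g\<close> is minimal the generator is nonnegative, so there the new density
    dominates the old one.  The minimum of \<open>g\<close>, and with it the new density, is positive.

  \<^item> Summation by parts against \<open>\<phi> = ln \<rho> + U = ln g\<close> turns the dissipation into a sum of
    terms \<open>w * (ln g' - ln g) * (g' - g)\<close>, which are nonnegative as \<open>ln\<close> is increasing.
    Against the constant \<open>\<phi> = 1\<close> it gives conservation of mass, so the increment \<open>\<delta>\<close> has zero
    mass.

  The entropy \<open>s ln s - s\<close> is convex with derivative \<open>ln s\<close>, so the lagged energy decreases by
  at least its linearisation at the new density, which is \<open>dt\<close> times the dissipation.
  The lagged potential is the linearisation of the true potential and interaction energy at the
  old density; as the interaction energy is quadratic and symmetric, the error is
  exactly its value \<open>R\<close> on the increment.  The supremum \<open>lambda_plus\<close> controls this form on grid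
  functions of zero mass, hence controls \<open>R\<close>, and both energy estimates follow.
\<close>

section \<open>The periodic grid\<close>

lemma nbr_less:
  assumes "N \<ge> 1"
  shows "nbr_right N i < N" "nbr_left N i < N"
  using assms by (auto simp: nbr_right_def nbr_left_def)

lemma nbr_right_left:
  assumes "i < N"
  shows "nbr_right N (nbr_left N i) = i"
proof (cases i)
  case 0
  then show ?thesis using assms by (simp add: nbr_right_def nbr_left_def)
next
  case (Suc k)
  then have "(i + N - 1) mod N = k" using assms by simp
  then show ?thesis using assms Suc by (simp add: nbr_right_def nbr_left_def)
qed

lemma nbr_left_right:
  assumes "i < N"
  shows "nbr_left N (nbr_right N i) = i"
proof (cases "i + 1 < N")
  case True
  then show ?thesis using assms by (simp add: nbr_right_def nbr_left_def)
next
  case False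
  then have "i + 1 = N" using assms by simp
  then show ?thesis by (auto simp: nbr_right_def nbr_left_def)
qed

lemma sum_periodic_shift:
  fixes f :: "nat \<Rightarrow> real"
  assumes "N \<ge> 1"
  shows "(\<Sum>i<N. f (nbr_left N i)) = (\<Sum>i<N. f i)"
  by (rule sum.reindex_bij_witness[of _ "nbr_right N" "nbr_left N"])
     (use assms in \<open>auto simp: nbr_less nbr_right_left nbr_left_right\<close>)

lemma summation_by_parts:
  fixes \<phi> J :: "nat \<Rightarrow> real"
  assumes "N \<ge> 1"
  shows "(\<Sum>i<N. \<phi> i * (J i - J (nbr_left N i)))
       = - (\<Sum>i<N. (\<phi> (nbr_right N i) - \<phi> i) * J i)"
proof -
  have "(\<Sum>i<N. \<phi> i * J (nbr_left N i))
      = (\<Sum>i<N. \<phi> (nbr_right N (nbr_left N i)) * J (nbr_left N i))"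
    by (rule sum.cong) (simp_all add: nbr_right_left)
  also have "\<dots> = (\<Sum>i<N. \<phi> (nbr_right N i) * J i)"
    by (rule sum_periodic_shift[OF assms])
  finally show ?thesis
    by (simp add: algebra_simps sum_subtractf)
qed

section \<open>The generator as a discrete divergence of a gradient flux\<close>

lemma log_mean_pos:
  assumes "a > 0" "b > 0"
  shows "log_mean a b > 0"
  using assms by (cases a b rule: linorder_cases)
    (auto simp: log_mean_def intro: divide_pos_pos divide_neg_neg)

lemma edge_value_pos: "edge_value r a b > 0"
  by (cases r) (auto simp: log_mean_pos add_pos_pos)

definition gradient_flux ::
  "nat \<Rightarrow> real \<Rightarrow> reconstruction \<Rightarrow> (nat \<Rightarrow> real) \<Rightarrow> (nat \<Rightarrow> real) \<Rightarrow> nat \<Rightarrow> real" where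
  "gradient_flux N h r U \<rho> i =
     edge_coeff N r U i / h\<^sup>2 *
       (exp (U (nbr_right N i)) * \<rho> (nbr_right N i) - exp (U i) * \<rho> i)"

abbreviation lagged_generator ::
  "nat \<Rightarrow> real \<Rightarrow> reconstruction \<Rightarrow> (nat \<Rightarrow> real) \<Rightarrow> (nat \<Rightarrow> real) \<Rightarrow> nat \<Rightarrow> real" where
  "lagged_generator N h r U \<equiv> generator N (forward_rate N h r U) (backward_rate N h r U)"

text \<open>Forward and backward rate of an edge share the factor \<open>\<gamma> / h\<^sup>2\<close>, and their exponential
  factors are those that turn \<open>\<rho>\<close> into \<open>g\<close> at the two ends of the edge.\<close>

lemma generator_eq_flux_difference:
  assumes "i < N"
  shows "lagged_generator N h r U \<rho> i
       = gradient_flux N h r U \<rho> i - gradient_flux N h r U \<rho> (nbr_left N i)"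
  by (simp add: generator_def forward_rate_def backward_rate_def gradient_flux_def
      nbr_right_left[OF assms] algebra_simps)

lemma inner_generator:
  assumes "N \<ge> 1"
  shows "inner_h N h \<phi> (lagged_generator N h r U \<rho>)
       = - h * (\<Sum>i<N. (\<phi> (nbr_right N i) - \<phi> i) * gradient_flux N h r U \<rho> i)"
proof -
  have "(\<Sum>i<N. \<phi> i * lagged_generator N h r U \<rho> i)
      = (\<Sum>i<N. \<phi> i * (gradient_flux N h r U \<rho> i - gradient_flux N h r U \<rho> (nbr_left N i)))"
    by (rule sum.cong) (simp_all add: generator_eq_flux_difference)
  then show ?thesis
    by (simp add: inner_h_def summation_by_parts[OF assms])
qed

lemma generator_mass_zero:
  assumes "N \<ge> 1"
  shows "(\<Sum>i<N. lagged_generator N h r U \<rho> i) = 0"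
  using summation_by_parts[OF assms, of "\<lambda>_. 1" "gradient_flux N h r U \<rho>"]
  by (simp add: generator_eq_flux_difference)

text \<open>Discrete minimum principle.  The columns of the matrix sum to zero, its rows in general do not,
  so it is the minimum of \<open>exp U * \<rho>\<close>, not that of \<open>\<rho>\<close>, at which both fluxes point
  into the node.\<close>

lemma implicit_step_pos:
  assumes "N \<ge> 1" and "dt \<ge> 0"
    and \<rho>0_pos: "\<And>i. i < N \<Longrightarrow> \<rho>0 i > 0"
    and step: "\<And>i. i < N \<Longrightarrow> \<rho>1 i - dt * lagged_generator N h r U \<rho>1 i = \<rho>0 i"
    and "i < N"
  shows "\<rho>1 i > 0"
proof -
  define g where "g j = exp (U j) * \<rho>1 j" for j
  have "Min (g ` {..<N}) \<in> g ` {..<N}"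
    using assms(1) by (intro Min_in) (auto simp: lessThan_empty_iff)
  then obtain m where m: "m < N" "g m = Min (g ` {..<N})" by auto
  have min: "g m \<le> g j" if "j < N" for j
    using that m by simp
  have w: "edge_coeff N r U j / h\<^sup>2 \<ge> 0" for j
    by (simp add: edge_coeff_def less_imp_le[OF edge_value_pos])
  have "gradient_flux N h r U \<rho>1 m \<ge> 0"
    using w[of m] min[OF nbr_less(1)[OF assms(1)]]
    unfolding gradient_flux_def g_def by (intro mult_nonneg_nonneg) auto
  moreover have "gradient_flux N h r U \<rho>1 (nbr_left N m) \<le> 0"
    using w[of "nbr_left N m"] min[OF nbr_less(2)[OF assms(1)]]
    unfolding gradient_flux_def g_def nbr_right_left[OF m(1)]
    by (intro mult_nonneg_nonpos) auto
  ultimately have "lagged_generator N h r U \<rho>1 m \<ge> 0"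
    by (simp add: generator_eq_flux_difference[OF m(1)])
  then have "dt * lagged_generator N h r U \<rho>1 m \<ge> 0"
    using assms(2) by simp
  then have "\<rho>1 m > 0"
    using step[OF m(1)] \<rho>0_pos[OF m(1)] by linarith
  then have "g m > 0" by (simp add: g_def)
  with min[OF \<open>i < N\<close>] have "g i > 0" by linarith
  then show ?thesis by (simp add: g_def zero_less_mult_iff)
qed

text \<open>Each edge contributes \<open>(ln g' - ln g) * (g' - g)\<close> with a positive weight, and
  both factors have the same sign.\<close>

lemma dissipation_nonneg:
  assumes "N \<ge> 1" and "h \<ge> 0" and pos: "\<And>i. i < N \<Longrightarrow> \<rho> i > 0"
  shows "inner_h N h (\<lambda>i. ln (\<rho> i) + U i) (lagged_generator N h r U \<rho>) \<le> 0"
proof -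
  have ln_mono: "(ln y - ln x) * (y - x) \<ge> 0" if "x > 0" "y > 0" for x y :: real
    using that by (cases "x \<le> y") (auto simp: mult_nonneg_nonneg mult_nonpos_nonpos)
  have "(ln (\<rho> (nbr_right N i)) + U (nbr_right N i) - (ln (\<rho> i) + U i))
          * gradient_flux N h r U \<rho> i \<ge> 0" if "i < N" for i
  proof -
    let ?g = "\<lambda>j. exp (U j) * \<rho> j" and ?k = "nbr_right N i"
    have p: "\<rho> i > 0" "\<rho> ?k > 0" using pos that nbr_less[OF assms(1)] by auto
    have "edge_coeff N r U i / h\<^sup>2 * ((ln (?g ?k) - ln (?g i)) * (?g ?k - ?g i)) \<ge> 0"
      using p by (intro mult_nonneg_nonneg ln_mono)
        (auto simp: edge_coeff_def less_imp_le[OF edge_value_pos])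
    moreover have "ln (?g i) = ln (\<rho> i) + U i" "ln (?g ?k) = ln (\<rho> ?k) + U ?k"
      using p by (simp_all add: ln_mult)
    ultimately show ?thesis
      by (simp only: gradient_flux_def mult.left_commute)
  qed
  then have "(\<Sum>i<N. (ln (\<rho> (nbr_right N i)) + U (nbr_right N i) - (ln (\<rho> i) + U i))
          * gradient_flux N h r U \<rho> i) \<ge> 0"
    by (intro sum_nonneg) auto
  then show ?thesis
    unfolding inner_generator[OF assms(1)] using assms(2) by (simp add: mult_nonneg_nonneg)
qed

section \<open>The two energies\<close>

text \<open>The tangent to \<open>s ln s - s\<close> at \<open>y\<close> lies below the graph; after division by \<open>x\<close>
  this is \<open>ln t \<le> t - 1\<close> for \<open>t = y / x\<close>.\<close>

lemma entropy_tangent: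
  fixes x y :: real
  assumes "x > 0" "y > 0"
  shows "(y * ln y - y) - (x * ln x - x) \<le> ln y * (y - x)"
proof -
  have "ln y - ln x \<le> y / x - 1"
    using ln_le_minus_one[of "y / x"] assms by (simp add: ln_div)
  then have "x * (ln y - ln x) \<le> x * (y / x - 1)"
    using assms by (intro mult_left_mono) auto
  also have "\<dots> = y - x" using assms by (simp add: field_simps)
  finally show ?thesis by (simp add: algebra_simps)
qed

lemma lagged_free_energy_convex:
  assumes "h \<ge> 0" and "\<And>i. i < N \<Longrightarrow> \<rho> i > 0" and "\<And>i. i < N \<Longrightarrow> \<rho>' i > 0"
  shows "lagged_free_energy N h U \<rho>' - lagged_free_energy N h U \<rho>
       \<le> inner_h N h (\<lambda>i. ln (\<rho>' i) + U i) (\<lambda>i. \<rho>' i - \<rho> i)"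
proof -
  have "(\<Sum>i<N. \<rho>' i * ln (\<rho>' i) - \<rho>' i + \<rho>' i * U i)
          - (\<Sum>i<N. \<rho> i * ln (\<rho> i) - \<rho> i + \<rho> i * U i)
      \<le> (\<Sum>i<N. (ln (\<rho>' i) + U i) * (\<rho>' i - \<rho> i))"
    unfolding sum_subtractf[symmetric]
  proof (rule sum_mono)
    fix i assume "i \<in> {..<N}"
    then show "\<rho>' i * ln (\<rho>' i) - \<rho>' i + \<rho>' i * U i - (\<rho> i * ln (\<rho> i) - \<rho> i + \<rho> i * U i)
        \<le> (ln (\<rho>' i) + U i) * (\<rho>' i - \<rho> i)"
      using entropy_tangent[of "\<rho> i" "\<rho>' i"] assms(2,3) by (simp add: algebra_simps)
  qed
  from mult_left_mono[OF this assms(1)] show ?thesis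
    by (simp add: lagged_free_energy_def inner_h_def right_diff_distrib)
qed

lemma interaction_symmetric:
  assumes "\<And>i j. i < N \<Longrightarrow> j < N \<Longrightarrow> K i j = K j i"
  shows "inner_h N h (interaction N h K u) v = inner_h N h (interaction N h K v) u"
proof -
  have "(\<Sum>i<N. \<Sum>j<N. K i j * u j * v i) = (\<Sum>j<N. \<Sum>i<N. K i j * u j * v i)"
    by (rule sum.swap)
  also have "\<dots> = (\<Sum>j<N. \<Sum>i<N. K j i * v i * u j)"
    using assms by (intro sum.cong) (auto simp: mult_ac)
  finally show ?thesis
    by (simp add: inner_h_def interaction_def sum_distrib_right mult.assoc
        sum_distrib_left[symmetric])
qed

lemma interaction_diff:
  "interaction N h K (\<lambda>i. u i - v i) = (\<lambda>i. interaction N h K u i - interaction N h K v i)"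
  by (intro ext) (simp add: interaction_def right_diff_distrib sum_subtractf)

lemma inner_h_diff_left:
  "inner_h N h (\<lambda>i. u i - v i) w = inner_h N h u w - inner_h N h v w"
  by (simp add: inner_h_def algebra_simps sum_subtractf)

lemma inner_h_diff_right:
  "inner_h N h w (\<lambda>i. u i - v i) = inner_h N h w u - inner_h N h w v"
  by (simp add: inner_h_def algebra_simps sum_subtractf)

lemma lagged_free_energy_eq:
  "lagged_free_energy N h (lagged_potential N h V K \<rho>0) \<rho>
     = free_energy N h V K \<rho> - 1/2 * inner_h N h (interaction N h K \<rho>) \<rho>
       + inner_h N h (interaction N h K \<rho>0) \<rho>"
  by (simp add: lagged_free_energy_def free_energy_def lagged_potential_def inner_h_def
      algebra_simps sum.distrib sum_subtractf)

text \<open>The true and the lagged energy difference differ by the second-order Taylor remainder of the interaction energy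
  at \<open>\<rho>\<close>; symmetry is what makes its derivative there the interaction part of the lagged
  potential.\<close>

lemma free_energy_difference:
  assumes sym: "\<And>i j. i < N \<Longrightarrow> j < N \<Longrightarrow> K i j = K j i"
    and U: "U = lagged_potential N h V K \<rho>"
  shows "free_energy N h V K \<rho>' - free_energy N h V K \<rho>
       = lagged_free_energy N h U \<rho>' - lagged_free_energy N h U \<rho>
         + 1/2 * inner_h N h (interaction N h K (\<lambda>i. \<rho>' i - \<rho> i)) (\<lambda>i. \<rho>' i - \<rho> i)"
proof -
  have "inner_h N h (interaction N h K \<rho>') \<rho> = inner_h N h (interaction N h K \<rho>) \<rho>'"
    by (rule interaction_symmetric[OF sym])
  then show ?thesis
    unfolding U lagged_free_energy_eq interaction_diff inner_h_diff_left inner_h_diff_right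
    by argo
qed

section \<open>The interaction on the zero-mass subspace\<close>

lemma norm_h_squared:
  assumes "h \<ge> 0"
  shows "(norm_h N h u)\<^sup>2 = inner_h N h u u"
  using assms by (simp add: norm_h_def inner_h_def sum_nonneg)

lemma norm_h_squared_pos:
  assumes "h > 0" and "i < N" and "u i \<noteq> 0"
  shows "(norm_h N h u)\<^sup>2 > 0"
proof -
  have "(\<Sum>i<N. u i * u i) > 0"
    using assms by (intro sum_pos2[of _ i]) (auto simp: zero_less_mult_iff)
  then show ?thesis
    using assms(1) by (simp add: norm_h_squared inner_h_def)
qed

text \<open>The product is one of extended reals, where \<open>\<infinity> * 0 = 0\<close>: a \<open>u\<close> that vanishes on the grid,
  for which there is no quotient, gives \<open>0\<close> on both sides whatever the supremum is.\<close>

lemma interaction_le_lambda_plus: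
  assumes "h > 0" and "(\<Sum>i<N. u i) = 0"
  shows "ereal (inner_h N h (interaction N h K u) u)
       \<le> lambda_plus N h K * ereal ((norm_h N h u)\<^sup>2)"
proof (cases "\<exists>i<N. u i \<noteq> 0")
  case True
  let ?q = "inner_h N h (interaction N h K u) u / (norm_h N h u)\<^sup>2"
  have pos: "(norm_h N h u)\<^sup>2 > 0"
    using True norm_h_squared_pos[OF assms(1)] by blast
  have "ereal ?q \<le> lambda_plus N h K"
    unfolding lambda_plus_def using True assms(2)
    by (intro max.coboundedI1 SUP_upper) auto
  then have "ereal ?q * ereal ((norm_h N h u)\<^sup>2) \<le> lambda_plus N h K * ereal ((norm_h N h u)\<^sup>2)"
    by (rule ereal_mult_right_mono) simp
  moreover have "ereal ?q * ereal ((norm_h N h u)\<^sup>2) = ereal (inner_h N h (interaction N h K u) u)"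
    using pos by simp
  ultimately show ?thesis by simp
next
  case False
  then show ?thesis
    using assms(1) by (simp add: norm_h_squared inner_h_def zero_ereal_def[symmetric])
qed

lemma lambda_plus_eq_0_iff:
  assumes "h > 0"
  shows "lambda_plus N h K = 0 \<longleftrightarrow>
    (\<forall>u. (\<Sum>i<N. u i) = 0 \<longrightarrow> inner_h N h (interaction N h K u) u \<le> 0)"
proof
  assume "lambda_plus N h K = 0"
  then show "\<forall>u. (\<Sum>i<N. u i) = 0 \<longrightarrow> inner_h N h (interaction N h K u) u \<le> 0"
    using interaction_le_lambda_plus[OF assms, of _ N K] by (auto simp: zero_ereal_def)
next
  assume "\<forall>u. (\<Sum>i<N. u i) = 0 \<longrightarrow> inner_h N h (interaction N h K u) u \<le> 0"
  then have "(SUP u \<in> {u. (\<exists>i<N. u i \<noteq> 0) \<and> (\<Sum>i<N. u i) = 0}.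
            ereal (inner_h N h (interaction N h K u) u / (norm_h N h u)\<^sup>2)) \<le> 0"
    by (intro SUP_least) (auto simp: divide_nonpos_nonneg)
  then show "lambda_plus N h K = 0"
    by (simp add: lambda_plus_def max_def)
qed

section \<open>Energy dissipation of the lagged scheme\<close>

theorem proposition5p2:
  fixes N :: nat and h dt I R :: real
    and V \<rho>0 \<rho>1 U \<delta> :: "nat \<Rightarrow> real"
    and K :: "nat \<Rightarrow> nat \<Rightarrow> real"
    and r :: reconstruction
    and A :: "(nat \<Rightarrow> real) \<Rightarrow> nat \<Rightarrow> real"
  assumes "N \<ge> 1" and "h > 0" and "dt > 0"
    and K_sym: "\<And>i j. i < N \<Longrightarrow> j < N \<Longrightarrow> K i j = K j i"
    and \<rho>0_pos: "\<And>i. i < N \<Longrightarrow> \<rho>0 i > 0"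
    and U_eq: "U = lagged_potential N h V K \<rho>0"
    and A_eq: "A = generator N (forward_rate N h r U) (backward_rate N h r U)"
    and step: "\<And>i. i < N \<Longrightarrow> \<rho>1 i - dt * A \<rho>1 i = \<rho>0 i"
    and \<delta>_eq: "\<delta> = (\<lambda>i. \<rho>1 i - \<rho>0 i)"
    and I_eq: "I = - inner_h N h (\<lambda>i. ln (\<rho>1 i) + U i) (A \<rho>1)"
    and R_eq: "R = 1/2 * inner_h N h (interaction N h K \<delta>) \<delta>"
  shows "(\<forall>i<N. \<rho>1 i > 0)
    \<and> I \<ge> 0
    \<and> free_energy N h V K \<rho>1 - free_energy N h V K \<rho>0
        = lagged_free_energy N h U \<rho>1 - lagged_free_energy N h U \<rho>0 + R
    \<and> lagged_free_energy N h U \<rho>1 - lagged_free_energy N h U \<rho>0 + R \<le> - dt * I + R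
    \<and> (lambda_plus N h K = 0 \<longleftrightarrow>
         (\<forall>u. (\<Sum>i<N. u i) = 0 \<longrightarrow> inner_h N h (interaction N h K u) u \<le> 0))
    \<and> (lambda_plus N h K = 0 \<longrightarrow>
         free_energy N h V K \<rho>1 - free_energy N h V K \<rho>0 \<le> - dt * I \<and> - dt * I \<le> 0)
    \<and> (lambda_plus N h K * ereal ((norm_h N h \<delta>)\<^sup>2) \<le> ereal (dt * I) \<longrightarrow>
         free_energy N h V K \<rho>1 - free_energy N h V K \<rho>0 \<le> - (dt / 2) * I
         \<and> - (dt / 2) * I \<le> 0)"
proof -
  have pos: "\<rho>1 i > 0" if "i < N" for i
    by (rule implicit_step_pos[OF \<open>N \<ge> 1\<close> less_imp_le[OF \<open>dt > 0\<close>] \<rho>0_pos step[unfolded A_eq] that])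
  have I_nonneg: "I \<ge> 0"
    using dissipation_nonneg[OF \<open>N \<ge> 1\<close> less_imp_le[OF \<open>h > 0\<close>] pos, where r = r and U = U]
    by (simp add: I_eq A_eq)
  have \<delta>: "\<delta> i = dt * A \<rho>1 i" if "i < N" for i
    using step[OF that] by (simp add: \<delta>_eq)
  have mass: "(\<Sum>i<N. \<delta> i) = 0"
    using generator_mass_zero[OF \<open>N \<ge> 1\<close>, of h r U \<rho>1]
    by (simp add: \<delta> A_eq sum_distrib_left[symmetric])
  have split: "free_energy N h V K \<rho>1 - free_energy N h V K \<rho>0
      = lagged_free_energy N h U \<rho>1 - lagged_free_energy N h U \<rho>0 + R"
    unfolding R_eq \<delta>_eq by (rule free_energy_difference[OF K_sym U_eq])
  have "inner_h N h (\<lambda>i. ln (\<rho>1 i) + U i) \<delta> = - dt * I"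
    by (simp add: I_eq inner_h_def \<delta> mult.left_commute sum_distrib_left[symmetric])
  then have lagged: "lagged_free_energy N h U \<rho>1 - lagged_free_energy N h U \<rho>0 \<le> - dt * I"
    using lagged_free_energy_convex[of h N \<rho>0 \<rho>1 U] \<open>h > 0\<close> \<rho>0_pos pos
    by (simp add: \<delta>_eq)
  have dtI: "dt * I \<ge> 0" using I_nonneg \<open>dt > 0\<close> by simp
  have R_nonpos: "R \<le> 0" if "lambda_plus N h K = 0"
    using that mass lambda_plus_eq_0_iff[OF \<open>h > 0\<close>] by (simp add: R_eq)
  have R_half: "R \<le> dt * I / 2" if "lambda_plus N h K * ereal ((norm_h N h \<delta>)\<^sup>2) \<le> ereal (dt * I)"
    using order_trans[OF interaction_le_lambda_plus[OF \<open>h > 0\<close> mass] that] by (simp add: R_eq)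
  have first: "free_energy N h V K \<rho>1 - free_energy N h V K \<rho>0 \<le> - dt * I \<and> - dt * I \<le> 0"
    if "lambda_plus N h K = 0"
    using split lagged dtI R_nonpos[OF that] by simp
  have second: "free_energy N h V K \<rho>1 - free_energy N h V K \<rho>0 \<le> - (dt / 2) * I
      \<and> - (dt / 2) * I \<le> 0"
    if "lambda_plus N h K * ereal ((norm_h N h \<delta>)\<^sup>2) \<le> ereal (dt * I)"
    using split lagged dtI R_half[OF that] by simp
  show ?thesis
    using pos I_nonneg split lagged lambda_plus_eq_0_iff[OF \<open>h > 0\<close>, of N K] first second
    by simp
qed

end
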